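(* Let $(X,T,G)$ and $(Y,S,G)$ be topological dynamical systems, where $G$ is an infinite countable discrete group with a right-invariant proper metric $\rho$ with symmetric horoballs space. Let $\pi\colon X\to Y$ be a factor map that is not bounded-to-one and such that $\mathrm{ND}_{\varepsilon,\pi}(X)$ is closed in $\partial G$ for every $\varepsilon>0$. Then $$\bigcap_{h\in\mathrm{ND}_\pi(X)}\{h<0\}\subseteq\mathrm{Tor}(G),$$ where $\mathrm{Tor}(G)$ is the set of torsion elements of $G$. In particular, if $G$ is torsion-free, the intersection $\bigcap_{h\in\mathrm{ND}_\pi(X)}\{h<0\}$ is empty.
   Context: A metric $\rho$ on $G$ is right-invariant if $\rho(gf,kf)=\rho(g,k)$ for all $g,k,f\in G$, and proper if every closed ball is finite. For $g\in G$ let $b_g\colon G\to\mathbb{R}$, $b_g(x)=\rho(g,x)-\rho(g,1_G)$. The border $\partial G$ is the set of functions $h\colon G\to\mathbb{R}$ for which there is a sequence $(g_n)$ in $G$ eventually leaving every finite subset of $G$ such that $b_{g_n}\to h$ pointwise; it carries the topology of pointwise convergence. Elements of $\partial G$ are called horofunctions, and the horoball of $h$ is $\{h<0\}=\{x\in G: h(x)<0\}$. $(G,\rho)$ has symmetric horoballs space if for any sequence $(g_n)$ in $G$ going to infinity such that both pointwise limits $h=\lim_n b_{g_n}$ and $h'=\lim_n b_{g_n^{-1}}$ exist, one has $\{g\in G: h(g^{-1})<0\}=\{g\in G: h'(g)<0\}$. A topological dynamical system $(X,T,G)$ is a compact metric space $(X,d)$ with a continuous action $T$ of $G$, written $T^g\colon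 X\to X$, with $T^{1_G}=\mathrm{id}_X$ and $T^{g}\circ T^{g'}=T^{gg'}$. A factor map is a continuous surjection $\pi$ with $\pi\circ T^g=S^g\circ\pi$ for all $g$; it is bounded-to-one if there is $M$ such that every fiber has at most $M$ points. $\mathrm{ND}_{\varepsilon,\pi}(X)$ is the set of $h\in\partial G$ for which there are distinct $x,y\in X$ with $\pi(x)=\pi(y)$ and $d(T^gx,T^gy)\le\varepsilon$ for all $g\in\{h<0\}$; $\mathrm{ND}_\pi(X)=\bigcap_{\varepsilon>0}\mathrm{ND}_{\varepsilon,\pi}(X)$. *)

theory Defs
  imports "HOL-Analysis.Analysis" "HOL-Algebra.Group"
begin

(* Functions G -> R are represented by the elements of extensional (carrier G), so that
   equality of such functions is equality on G and the topology of pointwise convergence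
   is the library's product topology powertop_real (carrier G). *)

definition right_invariant_metric :: "('g, 'm) monoid_scheme \<Rightarrow> ('g \<Rightarrow> 'g \<Rightarrow> real) \<Rightarrow> bool" where
  "right_invariant_metric G \<rho> \<longleftrightarrow>
     Metric_space (carrier G) \<rho> \<and>
     (\<forall>g\<in>carrier G. \<forall>k\<in>carrier G. \<forall>f\<in>carrier G. \<rho> (g \<otimes>\<^bsub>G\<^esub> f) (k \<otimes>\<^bsub>G\<^esub> f) = \<rho> g k)"

definition proper_metric :: "('g, 'm) monoid_scheme \<Rightarrow> ('g \<Rightarrow> 'g \<Rightarrow> real) \<Rightarrow> bool" where
  "proper_metric G \<rho> \<longleftrightarrow>
     (\<forall>g\<in>carrier G. \<forall>r. finite (Metric_space.mcball (carrier G) \<rho> g r))"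

definition bfun :: "('g, 'm) monoid_scheme \<Rightarrow> ('g \<Rightarrow> 'g \<Rightarrow> real) \<Rightarrow> 'g \<Rightarrow> 'g \<Rightarrow> real" where
  "bfun G \<rho> g = (\<lambda>x\<in>carrier G. \<rho> g x - \<rho> g \<one>\<^bsub>G\<^esub>)"

definition goes_to_infinity :: "('g, 'm) monoid_scheme \<Rightarrow> (nat \<Rightarrow> 'g) \<Rightarrow> bool" where
  "goes_to_infinity G g \<longleftrightarrow>
     (\<forall>n. g n \<in> carrier G) \<and>
     (\<forall>F. finite F \<and> F \<subseteq> carrier G \<longrightarrow> (\<forall>\<^sub>F n in sequentially. g n \<notin> F))"

definition border :: "('g, 'm) monoid_scheme \<Rightarrow> ('g \<Rightarrow> 'g \<Rightarrow> real) \<Rightarrow> ('g \<Rightarrow> real) set" where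
  "border G \<rho> =
     {h. \<exists>g. goes_to_infinity G g \<and>
             limitin (powertop_real (carrier G)) (\<lambda>n. bfun G \<rho> (g n)) h sequentially}"

definition border_topology ::
    "('g, 'm) monoid_scheme \<Rightarrow> ('g \<Rightarrow> 'g \<Rightarrow> real) \<Rightarrow> ('g \<Rightarrow> real) topology" where
  "border_topology G \<rho> = subtopology (powertop_real (carrier G)) (border G \<rho>)"

definition horoball :: "('g, 'm) monoid_scheme \<Rightarrow> ('g \<Rightarrow> real) \<Rightarrow> 'g set" where
  "horoball G h = {x \<in> carrier G. h x < 0}"

definition symmetric_horoballs_space ::
    "('g, 'm) monoid_scheme \<Rightarrow> ('g \<Rightarrow> 'g \<Rightarrow> real) \<Rightarrow> bool" where
  "symmetric_horoballs_space G \<rho> \<longleftrightarrow>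
     (\<forall>g h h'. goes_to_infinity G g \<and>
        limitin (powertop_real (carrier G)) (\<lambda>n. bfun G \<rho> (g n)) h sequentially \<and>
        limitin (powertop_real (carrier G)) (\<lambda>n. bfun G \<rho> (inv\<^bsub>G\<^esub> (g n))) h' sequentially \<longrightarrow>
        {x \<in> carrier G. h (inv\<^bsub>G\<^esub> x) < 0} = {x \<in> carrier G. h' x < 0})"

definition top_dyn_system ::
    "('g, 'm) monoid_scheme \<Rightarrow> 'x set \<Rightarrow> ('x \<Rightarrow> 'x \<Rightarrow> real) \<Rightarrow> ('g \<Rightarrow> 'x \<Rightarrow> 'x) \<Rightarrow> bool" where
  "top_dyn_system G X d T \<longleftrightarrow>
     Metric_space X d \<and>
     compact_space (Metric_space.mtopology X d) \<and>
     (\<forall>g\<in>carrier G.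
        continuous_map (Metric_space.mtopology X d) (Metric_space.mtopology X d) (T g)) \<and>
     (\<forall>x\<in>X. T \<one>\<^bsub>G\<^esub> x = x) \<and>
     (\<forall>g\<in>carrier G. \<forall>g'\<in>carrier G. \<forall>x\<in>X. T g (T g' x) = T (g \<otimes>\<^bsub>G\<^esub> g') x)"

definition factor_map ::
    "('g, 'm) monoid_scheme \<Rightarrow> 'x set \<Rightarrow> ('x \<Rightarrow> 'x \<Rightarrow> real) \<Rightarrow> ('g \<Rightarrow> 'x \<Rightarrow> 'x) \<Rightarrow>
     'y set \<Rightarrow> ('y \<Rightarrow> 'y \<Rightarrow> real) \<Rightarrow> ('g \<Rightarrow> 'y \<Rightarrow> 'y) \<Rightarrow> ('x \<Rightarrow> 'y) \<Rightarrow> bool" where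
  "factor_map G X d T Y d' S \<pi> \<longleftrightarrow>
     continuous_map (Metric_space.mtopology X d) (Metric_space.mtopology Y d') \<pi> \<and>
     \<pi> ` X = Y \<and>
     (\<forall>g\<in>carrier G. \<forall>x\<in>X. \<pi> (T g x) = S g (\<pi> x))"

definition bounded_to_one :: "'x set \<Rightarrow> 'y set \<Rightarrow> ('x \<Rightarrow> 'y) \<Rightarrow> bool" where
  "bounded_to_one X Y \<pi> \<longleftrightarrow>
     (\<exists>M::nat. \<forall>y\<in>Y. finite {x \<in> X. \<pi> x = y} \<and> card {x \<in> X. \<pi> x = y} \<le> M)"

definition ND_eps ::
    "('g, 'm) monoid_scheme \<Rightarrow> ('g \<Rightarrow> 'g \<Rightarrow> real) \<Rightarrow> 'x set \<Rightarrow> ('x \<Rightarrow> 'x \<Rightarrow> real) \<Rightarrow>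
     ('g \<Rightarrow> 'x \<Rightarrow> 'x) \<Rightarrow> ('x \<Rightarrow> 'y) \<Rightarrow> real \<Rightarrow> ('g \<Rightarrow> real) set" where
  "ND_eps G \<rho> X d T \<pi> \<epsilon> =
     {h \<in> border G \<rho>. \<exists>x\<in>X. \<exists>y\<in>X. x \<noteq> y \<and> \<pi> x = \<pi> y \<and>
        (\<forall>g\<in>horoball G h. d (T g x) (T g y) \<le> \<epsilon>)}"

definition ND ::
    "('g, 'm) monoid_scheme \<Rightarrow> ('g \<Rightarrow> 'g \<Rightarrow> real) \<Rightarrow> 'x set \<Rightarrow> ('x \<Rightarrow> 'x \<Rightarrow> real) \<Rightarrow>
     ('g \<Rightarrow> 'x \<Rightarrow> 'x) \<Rightarrow> ('x \<Rightarrow> 'y) \<Rightarrow> ('g \<Rightarrow> real) set" where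
  "ND G \<rho> X d T \<pi> = (\<Inter>\<epsilon>\<in>{0<..}. ND_eps G \<rho> X d T \<pi> \<epsilon>)"

definition Tor :: "('g, 'm) monoid_scheme \<Rightarrow> 'g set" where
  "Tor G = {g \<in> carrier G. \<exists>n::nat. n > 0 \<and> g [^]\<^bsub>G\<^esub> n = \<one>\<^bsub>G\<^esub>}"

definition torsion_free :: "('g, 'm) monoid_scheme \<Rightarrow> bool" where
  "torsion_free G \<longleftrightarrow> Tor G = {\<one>\<^bsub>G\<^esub>}"

end

(* The intersection is in fact empty: for every a in G some h in ND has h(a) >= 0.
   By compactness of the border it is enough to find such an h in ND_eps for each eps > 0.

   Suppose h(a) < 0 for all h in ND_eps, and let Z be the set of g in G at which a pair of points
   of one fibre is eps-close. Compactness and the symmetry of horoballs give a radius R, the same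
   for all pairs, such that if Z contains the open ball around g of radius s = rho(g,f) >= R
   and rho(a^-1 g, f) >= s, then f lies in Z. Hence for large r closeness on the ball B(g,r) passes
   on to B(ag,r), and closeness on all the balls B(a^n,r), n an integer, passes on to all of G.
   As pi is not bounded-to-one, the pigeonhole principle yields distinct points in one fibre that
   are eps-close on B(a^-k,r) for infinitely many k >= 0, hence on G. Thus ND_eps is the whole
   border, so that h(a) < 0 for every horofunction h. But if b_{u_n^-1} tends to h' and
   b_{u_n^-1 a} tends to h'', then h''(a) = -h'(a^-1), and symmetry makes the right-hand side
   positive. *)

theory Submission
  imports Defs "HOL-Complex_Analysis.Great_Picard"
begin

section \<open>Pointwise limits and limits of distances\<close>

lemma limitin_powertop_real_iff:
  "limitin (powertop_real I) f l sequentially \<longleftrightarrow>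
     l \<in> extensional I \<and> (\<forall>\<^sub>F n in sequentially. f n \<in> extensional I) \<and>
     (\<forall>i\<in>I. (\<lambda>n. f n i) \<longlonglongrightarrow> l i)"
  by (simp add: limitin_componentwise PiE_UNIV_domain PiE_def)

context Metric_space
begin

lemma tendsto_dist:
  assumes "limitin mtopology x a sequentially" "limitin mtopology y b sequentially"
  shows "(\<lambda>n. d (x n) (y n)) \<longlonglongrightarrow> d a b"
proof -
  have "limitin (prod_topology mtopology mtopology) (\<lambda>n. (x n, y n)) (a, b) sequentially"
    using assms by (simp add: limitin_pairwise o_def)
  moreover have "continuous_map (prod_topology mtopology mtopology) euclideanreal (\<lambda>(x, y). d x y)"
    using continuous_map_metric [of Self] by (simp add: mtopology_of_def)
  ultimately show ?thesis
    using continuous_map_limit by (fastforce simp: o_def)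
qed

end

section \<open>Right-invariant proper metrics: norms and closest pairs\<close>

locale proper_right_invariant = group G for G (structure) +
  fixes \<rho> :: "'a \<Rightarrow> 'a \<Rightarrow> real"
  assumes right_inv: "right_invariant_metric G \<rho>"
    and proper: "proper_metric G \<rho>"
    and countable_carrier: "countable (carrier G)"
    and infinite_carrier: "infinite (carrier G)"
begin

sublocale rho: Metric_space "carrier G" \<rho>
  using right_inv by (simp add: right_invariant_metric_def)

lemma rho_mult [simp]:
  "\<lbrakk>g \<in> carrier G; k \<in> carrier G; f \<in> carrier G\<rbrakk> \<Longrightarrow> \<rho> (g \<otimes> f) (k \<otimes> f) = \<rho> g k"
  using right_inv by (simp add: right_invariant_metric_def)

lemma rho_shift:
  assumes "g \<in> carrier G" "k \<in> carrier G" "f \<in> carrier G"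
  shows "\<rho> (g \<otimes> inv f) k = \<rho> g (k \<otimes> f)"
  using rho_mult[of "g \<otimes> inv f" k f] assms by (simp add: m_assoc del: rho_mult)

text \<open>Right translation by \<open>inv f\<close> carries the pair \<open>(g, f)\<close> to
  \<open>(g \<otimes> inv f, \<one>)\<close>. Distances thus become norms, the norm of an element
  being its distance to \<open>\<one>\<close>.\<close>

lemma rho_quotient:
  assumes "g \<in> carrier G" "f \<in> carrier G"
  shows "\<rho> (g \<otimes> inv f) \<one> = \<rho> g f"
  using rho_shift[of g \<one> f] assms by simp

lemma rho_inv:
  assumes "g \<in> carrier G"
  shows "\<rho> (inv g) \<one> = \<rho> g \<one>"
  using rho_quotient[of \<one> g] assms by (simp add: rho.commute)

lemma finite_norm_le: "finite {g \<in> carrier G. \<rho> g \<one> \<le> r}"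
proof -
  have "{g \<in> carrier G. \<rho> g \<one> \<le> r} \<subseteq> rho.mcball \<one> r"
    by (auto simp: rho.commute)
  then show ?thesis
    using proper by (meson finite_subset one_closed proper_metric_def)
qed

text \<open>Properness leaves only finitely many candidates below the norm of any one member of
  \<open>A\<close>, so the infimum is attained.\<close>

lemma minimal_norm:
  assumes "A \<subseteq> carrier G" "A \<noteq> {}"
  obtains u where "u \<in> A" "\<And>v. v \<in> A \<Longrightarrow> \<rho> u \<one> \<le> \<rho> v \<one>"
proof -
  obtain w where w: "w \<in> A" using assms by blast
  let ?B = "{v \<in> A. \<rho> v \<one> \<le> \<rho> w \<one>}"
  have fin: "finite ?B"
    by (rule finite_subset[OF _ finite_norm_le[of "\<rho> w \<one>"]]) (use assms in auto)
  have "?B \<noteq> {}" using w by auto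
  from arg_min_if_finite[OF fin this, of "\<lambda>v. \<rho> v \<one>"]
  obtain u where "u \<in> ?B" "\<forall>v\<in>?B. \<rho> u \<one> \<le> \<rho> v \<one>"
    by (meson linorder_not_less)
  then have "u \<in> A" "\<And>v. v \<in> A \<Longrightarrow> \<rho> u \<one> \<le> \<rho> v \<one>" by force+
  then show thesis by (rule that)
qed

text \<open>The distance of a pair is the norm of its quotient \<open>g \<otimes> inv f\<close>, so
  even an infinite family of pairs has a closest one. Both spreading arguments start from such a
  pair.\<close>

lemma minimal_pair:
  assumes "A \<subseteq> carrier G \<times> carrier G" "A \<noteq> {}"
  obtains g f where "(g, f) \<in> A" "\<And>g' f'. (g', f') \<in> A \<Longrightarrow> \<rho> g f \<le> \<rho> g' f'"
proof -
  let ?A = "(\<lambda>(g, f). g \<otimes> inv f) ` A"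
  have "?A \<subseteq> carrier G" "?A \<noteq> {}" using assms by auto
  then obtain u where u: "u \<in> ?A" "\<And>v. v \<in> ?A \<Longrightarrow> \<rho> u \<one> \<le> \<rho> v \<one>"
    by (rule minimal_norm) blast
  from u(1) obtain g f where gf: "(g, f) \<in> A" "u = g \<otimes> inv f" by auto
  have "\<rho> g f \<le> \<rho> g' f'" if "(g', f') \<in> A" for g' f'
  proof -
    have "\<rho> u \<one> \<le> \<rho> (g' \<otimes> inv f') \<one>" using that by (intro u(2)) force
    moreover have "g \<in> carrier G" "f \<in> carrier G" "g' \<in> carrier G" "f' \<in> carrier G"
      using gf that assms by auto
    ultimately show ?thesis by (simp add: gf(2) rho_quotient)
  qed
  with gf show thesis using that by blast
qed

section \<open>Spreading of a set from balls\<close>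

text \<open>The closure rule from the overview. The point \<open>f\<close> lies just outside the
  open ball assumed to be in \<open>Z\<close>; the last inequality says that replacing the centre
  \<open>g\<close> by \<open>inv a \<otimes> g\<close> brings it no nearer.\<close>

definition spreading :: "'a \<Rightarrow> real \<Rightarrow> 'a set \<Rightarrow> bool" where
  "spreading a R Z \<longleftrightarrow>
     (\<forall>g\<in>carrier G. \<forall>f\<in>carrier G. R \<le> \<rho> g f \<longrightarrow> rho.mball g (\<rho> g f) \<subseteq> Z \<longrightarrow>
        \<rho> g f \<le> \<rho> (inv a \<otimes> g) f \<longrightarrow> f \<in> Z)"

lemma spreading_translate:
  assumes Z: "spreading a R Z" and a: "a \<in> carrier G" and g: "g \<in> carrier G"
    and r: "R + \<rho> a \<one> \<le> r" and sub: "rho.mball g r \<subseteq> Z"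
  shows "rho.mball (a \<otimes> g) r \<subseteq> Z"
proof (rule ccontr)
  assume contra: "\<not> ?thesis"
  \<comment> \<open>At a missing point \<open>f\<close> closest to \<open>a \<otimes> g\<close> the spreading rule applies with centre \<open>a \<otimes> g\<close>,
    because \<open>f\<close> lies outside the ball around \<open>g = inv a \<otimes> (a \<otimes> g)\<close>.\<close>
  let ?A = "{(a \<otimes> g, f) |f. f \<in> rho.mball (a \<otimes> g) r - Z}"
  have "?A \<subseteq> carrier G \<times> carrier G" "?A \<noteq> {}"
    using contra a g by auto
  then obtain g' f where f': "(g', f) \<in> ?A" and min: "\<And>g'' f'. (g'', f') \<in> ?A \<Longrightarrow> \<rho> g' f \<le> \<rho> g'' f'"
    by (rule minimal_pair) blast
  have g': "g' = a \<otimes> g" and f: "f \<in> carrier G" "\<rho> (a \<otimes> g) f < r" "f \<notin> Z"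
    using f' by auto
  have far: "r \<le> \<rho> g f" using sub f g by force
  \<comment> \<open>The centre moves by the norm of \<open>a\<close>, so a point at distance at
    least \<open>r\<close> from \<open>g\<close> is still at distance at least
    \<open>r - \<rho> a \<one>\<close>, hence at least \<open>R\<close>, from
    \<open>a \<otimes> g\<close>.\<close>
  have "\<rho> g (a \<otimes> g) = \<rho> a \<one>"
    using rho_mult[of \<one> a g] a g by (simp add: rho.commute del: rho_mult)
  then have R: "R \<le> \<rho> (a \<otimes> g) f"
    using rho.triangle[of g "a \<otimes> g" f] far r a g f by simp
  have "rho.mball (a \<otimes> g) (\<rho> (a \<otimes> g) f) \<subseteq> Z"
  proof
    fix k assume k: "k \<in> rho.mball (a \<otimes> g) (\<rho> (a \<otimes> g) f)"
    show "k \<in> Z"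
    proof (rule ccontr)
      assume "k \<notin> Z"
      then have "(a \<otimes> g, k) \<in> ?A" using k f by auto
      from min[OF this] show False using k g' by simp
    qed
  qed
  moreover have "inv a \<otimes> (a \<otimes> g) = g" using a g by (simp add: m_assoc[symmetric])
  then have "\<rho> (a \<otimes> g) f \<le> \<rho> (inv a \<otimes> (a \<otimes> g)) f" using f far by simp
  ultimately have "f \<in> Z"
    using Z R f a g unfolding spreading_def by (meson m_closed)
  with f show False by simp
qed

text \<open>Balls travel along \<open>a\<close> in the forward direction only. Reaching every
  integer power of \<open>a\<close> therefore requires starting balls at arbitrarily negative
  exponents.\<close>

lemma spreading_translate_power:
  assumes Z: "spreading a R Z" and a: "a \<in> carrier G" and g: "g \<in> carrier G"
    and r: "R + \<rho> a \<one> \<le> r" and sub: "rho.mball g r \<subseteq> Z"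
  shows "rho.mball (a [^] (n::nat) \<otimes> g) r \<subseteq> Z"
proof (induction n)
  case (Suc n)
  have "a [^] Suc n \<otimes> g = a \<otimes> (a [^] n \<otimes> g)"
    using a g by (simp only: nat_pow_Suc2 m_assoc nat_pow_closed)
  then show ?case
    using spreading_translate[OF Z a _ r Suc] a g by simp
qed (use g sub in simp)

text \<open>The same minimal-distance argument, with all centres \<open>a\<^sup>n\<close> competing at once: the pair
  \<open>(a\<^sup>n\<^sup>-\<^sup>1, f)\<close> cannot beat a closest pair \<open>(a\<^sup>n, f)\<close>.\<close>
lemma spreading_all:
  assumes Z: "spreading a R Z" and a: "a \<in> carrier G" and r: "R \<le> r"
    and sub: "\<And>n::int. rho.mball (a [^] n) r \<subseteq> Z"
  shows "carrier G \<subseteq> Z"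
proof (rule ccontr)
  assume contra: "\<not> ?thesis"
  let ?A = "{(a [^] n, f) |(n::int) f. f \<in> carrier G - Z}"
  have "?A \<subseteq> carrier G \<times> carrier G" "?A \<noteq> {}"
    using contra a by auto
  then obtain g f where gf: "(g, f) \<in> ?A" and min: "\<And>g' f'. (g', f') \<in> ?A \<Longrightarrow> \<rho> g f \<le> \<rho> g' f'"
    by (rule minimal_pair) blast
  obtain n :: int where g: "g = a [^] n" and f: "f \<in> carrier G" "f \<notin> Z"
    using gf by auto
  have gc: "g \<in> carrier G" using g a by simp
  have "r \<le> \<rho> g f" using sub[of n] f gc g by force
  moreover have "rho.mball g (\<rho> g f) \<subseteq> Z"
  proof
    fix k assume k: "k \<in> rho.mball g (\<rho> g f)"
    show "k \<in> Z"
    proof (rule ccontr)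
      assume "k \<notin> Z"
      then have "(g, k) \<in> ?A" using k g by auto
      from min[OF this] show False using k by simp
    qed
  qed
  moreover have "inv a \<otimes> g = a [^] (n - 1)"
    using int_pow_mult[OF a, of "-1" n] a by (simp add: g int_pow_neg)
  then have "(inv a \<otimes> g, f) \<in> ?A" using f by auto
  from min[OF this] have "\<rho> g f \<le> \<rho> (inv a \<otimes> g) f" .
  ultimately have "f \<in> Z"
    using Z r f gc by (simp add: spreading_def)
  with f show False by simp
qed

section \<open>Horofunctions and sequential compactness of the border\<close>

lemma goes_to_infinityI:
  assumes "\<And>n. g n \<in> carrier G" "\<And>n. real n \<le> \<rho> (g n) \<one>"
  shows "goes_to_infinity G g"
  unfolding goes_to_infinity_def
proof (intro conjI allI impI)
  fix F assume F: "finite F \<and> F \<subseteq> carrier G"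
  then have "bdd_above ((\<lambda>x. \<rho> x \<one>) ` F)" by auto
  then obtain b where b: "\<And>x. x \<in> F \<Longrightarrow> \<rho> x \<one> \<le> b"
    by (auto simp: bdd_above_def)
  obtain N where N: "b < real N" using reals_Archimedean2 by blast
  have "g n \<notin> F" if "N \<le> n" for n
    using b[of "g n"] assms(2)[of n] N that by fastforce
  then show "\<forall>\<^sub>F n in sequentially. g n \<notin> F"
    by (auto simp: eventually_sequentially)
qed (use assms in auto)

lemma bfun_bound:
  assumes "g \<in> carrier G" "x \<in> carrier G"
  shows "\<bar>bfun G \<rho> g x\<bar> \<le> \<rho> x \<one>"
  using assms rho.triangle[of g x \<one>] rho.triangle[of g \<one> x]
  by (simp add: bfun_def rho.commute abs_le_iff)

text \<open>A diagonal argument over the countable set \<open>carrier G\<close>. It serves both for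
  the functions \<open>bfun G \<rho> g\<close> and for horofunctions, which obey the same
  bound.\<close>

lemma convergent_subsequence:
  assumes ext: "\<And>n::nat. H n \<in> extensional (carrier G)"
    and bd: "\<And>n x. x \<in> carrier G \<Longrightarrow> \<bar>H n x\<bar> \<le> \<rho> x \<one>"
  obtains r h where "strict_mono (r::nat\<Rightarrow>nat)"
    "limitin (powertop_real (carrier G)) (H \<circ> r) h sequentially"
proof -
  \<comment> \<open>The bound depends on \<open>x\<close>; dividing by the positive number
    \<open>\<rho> x \<one> + 1\<close> makes it uniform, and multiplying back preserves convergence
    at each point.\<close>
  have "norm (H n x / (\<rho> x \<one> + 1)) \<le> 1" if "x \<in> carrier G" for n x
  proof -
    have "0 < \<rho> x \<one> + 1" using rho.nonneg[of x \<one>] by linarith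
    then show ?thesis using bd[OF that, of n] by (simp add: abs_divide)
  qed
  then obtain r where r: "strict_mono (r::nat\<Rightarrow>nat)"
    and lim: "\<And>x. x \<in> carrier G \<Longrightarrow> \<exists>l. (\<lambda>n. H (r n) x / (\<rho> x \<one> + 1)) \<longlonglongrightarrow> l"
    using function_convergent_subsequence[OF countable_carrier, of "\<lambda>n x. H n x / (\<rho> x \<one> + 1)" 1]
    by blast
  have "\<exists>l. (\<lambda>n. H (r n) x) \<longlonglongrightarrow> l" if x: "x \<in> carrier G" for x
  proof -
    obtain l where "(\<lambda>n. H (r n) x / (\<rho> x \<one> + 1)) \<longlonglongrightarrow> l" using lim[OF x] by blast
    then have "(\<lambda>n. H (r n) x / (\<rho> x \<one> + 1) * (\<rho> x \<one> + 1)) \<longlonglongrightarrow> l * (\<rho> x \<one> + 1)"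
      by (rule tendsto_mult_right)
    moreover have "\<rho> x \<one> + 1 \<noteq> 0" using rho.nonneg[of x \<one>] by linarith
    ultimately show ?thesis by auto
  qed
  then obtain l where l: "\<And>x. x \<in> carrier G \<Longrightarrow> (\<lambda>n. H (r n) x) \<longlonglongrightarrow> l x" by metis
  have "limitin (powertop_real (carrier G)) (H \<circ> r) (restrict l (carrier G)) sequentially"
    using ext l by (simp add: limitin_powertop_real_iff)
  with r show thesis by (rule that)
qed

lemma bfun_extensional: "bfun G \<rho> g \<in> extensional (carrier G)"
  by (simp add: bfun_def)

lemma bfun_convergent_subsequence:
  assumes "\<And>n. g n \<in> carrier G"
  obtains r h where "strict_mono (r::nat\<Rightarrow>nat)"
    "limitin (powertop_real (carrier G)) (\<lambda>n. bfun G \<rho> (g (r n))) h sequentially"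
proof (rule convergent_subsequence[of "\<lambda>n. bfun G \<rho> (g n)"])
  fix r h
  assume "strict_mono (r::nat\<Rightarrow>nat)"
    "limitin (powertop_real (carrier G)) ((\<lambda>n. bfun G \<rho> (g n)) \<circ> r) h sequentially"
  then show thesis using that by (simp add: o_def)
qed (use bfun_bound[OF assms] bfun_extensional in auto)

lemma border_bound:
  assumes "h \<in> border G \<rho>"
  shows "h \<in> extensional (carrier G)" "\<And>x. x \<in> carrier G \<Longrightarrow> \<bar>h x\<bar> \<le> \<rho> x \<one>"
proof -
  obtain g where g: "goes_to_infinity G g"
    and lim: "limitin (powertop_real (carrier G)) (\<lambda>n. bfun G \<rho> (g n)) h sequentially"
    using assms by (auto simp: border_def)
  show "h \<in> extensional (carrier G)" using lim by (simp add: limitin_powertop_real_iff)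
  fix x assume x: "x \<in> carrier G"
  have "(\<lambda>n. \<bar>bfun G \<rho> (g n) x\<bar>) \<longlonglongrightarrow> \<bar>h x\<bar>"
    using lim x by (simp add: limitin_powertop_real_iff tendsto_rabs)
  then show "\<bar>h x\<bar> \<le> \<rho> x \<one>"
    by (rule Lim_bounded) (use g x bfun_bound in \<open>auto simp: goes_to_infinity_def\<close>)
qed

text \<open>Any term far enough along a sequence defining \<open>h\<close> will do. The arbitrary
  lower bound \<open>r\<close> on the norm lets approximants of different horofunctions be assembled
  into one sequence going to infinity.\<close>

lemma border_approx:
  assumes h: "h \<in> border G \<rho>" and F: "finite F" "F \<subseteq> carrier G" and "e > 0"
  obtains g where "g \<in> carrier G" "r \<le> \<rho> g \<one>" "\<And>x. x \<in> F \<Longrightarrow> \<bar>bfun G \<rho> g x - h x\<bar> < e"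
proof -
  obtain g where g: "goes_to_infinity G g"
    and lim: "limitin (powertop_real (carrier G)) (\<lambda>n. bfun G \<rho> (g n)) h sequentially"
    using h by (auto simp: border_def)
  have "\<forall>\<^sub>F n in sequentially. g n \<notin> {x \<in> carrier G. \<rho> x \<one> \<le> r}"
    using g finite_norm_le[of r] by (auto simp: goes_to_infinity_def)
  moreover have "\<forall>\<^sub>F n in sequentially. \<bar>bfun G \<rho> (g n) x - h x\<bar> < e" if "x \<in> F" for x
    using lim that F tendstoD[OF _ \<open>e > 0\<close>]
    by (fastforce simp: limitin_powertop_real_iff dist_real_def)
  then have "\<forall>\<^sub>F n in sequentially. \<forall>x\<in>F. \<bar>bfun G \<rho> (g n) x - h x\<bar> < e"
    using F by (intro eventually_ball_finite) auto
  ultimately have "\<forall>\<^sub>F n in sequentially. g n \<notin> {x \<in> carrier G. \<rho> x \<one> \<le> r} \<and>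
      (\<forall>x\<in>F. \<bar>bfun G \<rho> (g n) x - h x\<bar> < e)"
    by (rule eventually_conj)
  then obtain n where "g n \<notin> {x \<in> carrier G. \<rho> x \<one> \<le> r}" "\<forall>x\<in>F. \<bar>bfun G \<rho> (g n) x - h x\<bar> < e"
    by (auto simp: eventually_sequentially)
  moreover have "g n \<in> carrier G" using g by (simp add: goes_to_infinity_def)
  ultimately show thesis using that[of "g n"] by force
qed

lemma border_compact:
  assumes h: "\<And>n::nat. h n \<in> border G \<rho>"
  obtains r l where "strict_mono (r::nat\<Rightarrow>nat)" "l \<in> border G \<rho>"
    "limitin (powertop_real (carrier G)) (h \<circ> r) l sequentially"
proof -
  obtain r l where r: "strict_mono (r::nat\<Rightarrow>nat)"
    and lim: "limitin (powertop_real (carrier G)) (h \<circ> r) l sequentially"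
    by (rule convergent_subsequence[of h, OF border_bound[OF h]])
  \<comment> \<open>These finite sets exhaust the group. Approximating the \<open>n\<close>-th
    horofunction on \<open>F n\<close> up to \<open>1/(n+1)\<close> by a \<open>bfun\<close> of norm
    at least \<open>n\<close> shows that the limit \<open>l\<close> is itself a
    horofunction.\<close>
  define F where "F n = from_nat_into (carrier G) ` {..n}" for n
  have F: "finite (F n)" "F n \<subseteq> carrier G" for n
    using from_nat_into[of "carrier G"] by (auto simp: F_def)
  have "\<exists>g\<in>carrier G. real n \<le> \<rho> g \<one> \<and>
      (\<forall>x\<in>F n. \<bar>bfun G \<rho> g x - (h \<circ> r) n x\<bar> < inverse (real (Suc n)))" for n
  proof -
    have "(h \<circ> r) n \<in> border G \<rho>" "0 < inverse (real (Suc n))" using h by simp_all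
    then obtain g where "g \<in> carrier G" "real n \<le> \<rho> g \<one>"
      "\<And>x. x \<in> F n \<Longrightarrow> \<bar>bfun G \<rho> g x - (h \<circ> r) n x\<bar> < inverse (real (Suc n))"
      using border_approx[where h = "(h \<circ> r) n" and r = "real n", OF _ F[of n]] by metis
    then show ?thesis by blast
  qed
  then obtain g where g: "\<And>n. g n \<in> carrier G" "\<And>n. real n \<le> \<rho> (g n) \<one>"
    and close: "\<And>n x. x \<in> F n \<Longrightarrow> \<bar>bfun G \<rho> (g n) x - (h \<circ> r) n x\<bar> < inverse (real (Suc n))"
    by metis
  have "(\<lambda>n. bfun G \<rho> (g n) x) \<longlonglongrightarrow> l x" if x: "x \<in> carrier G" for x
  proof -
    obtain N where N: "x = from_nat_into (carrier G) N"
      using from_nat_into_surj[OF countable_carrier x] by metis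
    have "\<forall>\<^sub>F n in sequentially. norm (bfun G \<rho> (g n) x - (h \<circ> r) n x) \<le> inverse (real (Suc n))"
      unfolding eventually_sequentially
    proof (intro exI[of _ N] allI impI)
      fix n assume "N \<le> n"
      then have "x \<in> F n" by (auto simp: F_def N)
      from close[OF this] show "norm (bfun G \<rho> (g n) x - (h \<circ> r) n x) \<le> inverse (real (Suc n))"
        by simp
    qed
    then have "(\<lambda>n. bfun G \<rho> (g n) x - (h \<circ> r) n x) \<longlonglongrightarrow> 0"
      by (rule Lim_null_comparison) (rule LIMSEQ_inverse_real_of_nat)
    moreover have "(\<lambda>n. (h \<circ> r) n x) \<longlonglongrightarrow> l x"
      using lim x by (simp add: limitin_powertop_real_iff)
    ultimately have "(\<lambda>n. bfun G \<rho> (g n) x - (h \<circ> r) n x + (h \<circ> r) n x) \<longlonglongrightarrow> 0 + l x"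
      by (rule tendsto_add)
    then show ?thesis by simp
  qed
  then have "limitin (powertop_real (carrier G)) (\<lambda>n. bfun G \<rho> (g n)) l sequentially"
    using lim by (simp add: limitin_powertop_real_iff bfun_extensional)
  then have "l \<in> border G \<rho>"
    unfolding border_def using goes_to_infinityI[OF g] by blast
  from that[OF r this lim] show thesis .
qed

lemma goes_to_infinity_subseq:
  assumes "\<And>n. u n \<in> carrier G" "\<And>n. real n \<le> \<rho> (u n) \<one>" "strict_mono r"
  shows "goes_to_infinity G (\<lambda>n. u (r n))" "goes_to_infinity G (\<lambda>n. inv (u (r n)))"
proof -
  have "real n \<le> \<rho> (u (r n)) \<one>" for n
    using assms(2)[of "r n"] seq_suble[OF assms(3), of n] by linarith
  then show "goes_to_infinity G (\<lambda>n. u (r n))" "goes_to_infinity G (\<lambda>n. inv (u (r n)))"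
    using assms(1) by (auto intro!: goes_to_infinityI simp: rho_inv)
qed

lemma unbounded: "\<exists>u\<in>carrier G. r \<le> \<rho> u \<one>"
proof (rule ccontr)
  assume "\<not> ?thesis"
  then have "carrier G \<subseteq> {g \<in> carrier G. \<rho> g \<one> \<le> r}" by force
  then show False using infinite_carrier finite_norm_le finite_subset by blast
qed

end

section \<open>Pairs in a common fibre and their close sets\<close>

locale horoball_factor = proper_right_invariant G \<rho>
  for G :: "('a, 'm) monoid_scheme" (structure) and \<rho> :: "'a \<Rightarrow> 'a \<Rightarrow> real" +
  fixes X :: "'x set" and d :: "'x \<Rightarrow> 'x \<Rightarrow> real" and T :: "'a \<Rightarrow> 'x \<Rightarrow> 'x"
    and Y :: "'y set" and d' :: "'y \<Rightarrow> 'y \<Rightarrow> real" and S :: "'a \<Rightarrow> 'y \<Rightarrow> 'y"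
    and \<pi> :: "'x \<Rightarrow> 'y"
  assumes symmetric: "symmetric_horoballs_space G \<rho>"
    and system_X: "top_dyn_system G X d T"
    and system_Y: "top_dyn_system G Y d' S"
    and factor: "factor_map G X d T Y d' S \<pi>"
begin

sublocale mX: Metric_space X d
  using system_X by (simp add: top_dyn_system_def)

sublocale mY: Metric_space Y d'
  using system_Y by (simp add: top_dyn_system_def)

lemma T_continuous: "k \<in> carrier G \<Longrightarrow> continuous_map mX.mtopology mX.mtopology (T k)"
  using system_X by (simp add: top_dyn_system_def)

lemma T_closed: "\<lbrakk>k \<in> carrier G; x \<in> X\<rbrakk> \<Longrightarrow> T k x \<in> X"
  using T_continuous[of k] by (auto simp: continuous_map_def)

lemma T_mult: "\<lbrakk>g \<in> carrier G; k \<in> carrier G; x \<in> X\<rbrakk> \<Longrightarrow> T g (T k x) = T (g \<otimes> k) x"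
  using system_X by (simp add: top_dyn_system_def)

lemma factor_equivariant: "\<lbrakk>g \<in> carrier G; x \<in> X\<rbrakk> \<Longrightarrow> \<pi> (T g x) = S g (\<pi> x)"
  using factor by (simp add: factor_map_def)

lemma compact_X: "compact_space mX.mtopology"
  using system_X by (simp add: top_dyn_system_def)

text \<open>Compactness of \<open>X\<close> is used twice, the second time along the first
  subsequence. The limits share a fibre because \<open>\<pi>\<close> is continuous and limits in
  \<open>Y\<close> are unique.\<close>

lemma fibre_pairs_compact:
  assumes "\<And>n::nat. x n \<in> X" "\<And>n. y n \<in> X" "\<And>n. \<pi> (x n) = \<pi> (y n)"
  obtains r a b where "strict_mono (r::nat\<Rightarrow>nat)" "a \<in> X" "b \<in> X" "\<pi> a = \<pi> b"
    "limitin mX.mtopology (x \<circ> r) a sequentially" "limitin mX.mtopology (y \<circ> r) b sequentially"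
proof -
  have seq: "\<exists>l r. l \<in> X \<and> strict_mono r \<and> limitin mX.mtopology (\<sigma> \<circ> r) l sequentially"
    if "range \<sigma> \<subseteq> X" for \<sigma> :: "nat \<Rightarrow> 'x"
    using compact_X that unfolding mX.compact_space_sequentially by blast
  have "range x \<subseteq> X" using assms by auto
  from seq[OF this] obtain a r where r: "a \<in> X" "strict_mono r"
    "limitin mX.mtopology (x \<circ> r) a sequentially" by blast
  have "range (y \<circ> r) \<subseteq> X" using assms by auto
  from seq[OF this] obtain b s where s: "b \<in> X" "strict_mono s"
    "limitin mX.mtopology (y \<circ> r \<circ> s) b sequentially" by blast
  have xl: "limitin mX.mtopology (x \<circ> (r \<circ> s)) a sequentially"
    using limitin_subsequence[OF s(2) r(3)] by (simp add: o_assoc)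
  have yl: "limitin mX.mtopology (y \<circ> (r \<circ> s)) b sequentially"
    using s(3) by (simp add: o_assoc)
  have cont: "continuous_map mX.mtopology mY.mtopology \<pi>"
    using factor by (simp add: factor_map_def)
  have "\<pi> \<circ> (x \<circ> (r \<circ> s)) = \<pi> \<circ> (y \<circ> (r \<circ> s))" using assms by auto
  then have "\<pi> a = \<pi> b"
    using continuous_map_limit[OF cont xl] continuous_map_limit[OF cont yl]
    by (auto intro: mY.limitin_metric_unique[of _ _ sequentially])
  with that[OF strict_mono_o[OF r(2) s(2)] r(1) s(1) _ xl yl] show thesis by blast
qed

text \<open>This is the set called Z in the overview, to which \<open>spreading\<close> is
  applied.\<close>

definition close_set :: "real \<Rightarrow> 'x \<Rightarrow> 'x \<Rightarrow> 'a set" where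
  "close_set \<epsilon> x y = {k \<in> carrier G. d (T k x) (T k y) \<le> \<epsilon>}"

lemma close_set_translate:
  assumes "x \<in> X" "y \<in> X" "f \<in> carrier G" "k \<in> carrier G"
  shows "k \<in> close_set \<epsilon> (T f x) (T f y) \<longleftrightarrow> k \<otimes> f \<in> close_set \<epsilon> x y"
  using assms by (simp add: close_set_def T_mult)

lemma ND_eps_mono:
  assumes "\<epsilon> \<le> \<epsilon>'"
  shows "ND_eps G \<rho> X d T \<pi> \<epsilon> \<subseteq> ND_eps G \<rho> X d T \<pi> \<epsilon>'"
  using assms unfolding ND_eps_def by (blast intro: order_trans)

section \<open>Consequences of the symmetry of horoballs\<close>

text \<open>The symmetry hypothesis evaluated at the point \<open>inv a\<close>; it enters the proof
  only through this lemma.\<close>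

lemma horoball_inv:
  assumes "goes_to_infinity G u" "a \<in> carrier G" "h a < 0"
    and "limitin (powertop_real (carrier G)) (\<lambda>n. bfun G \<rho> (u n)) h sequentially"
    and "limitin (powertop_real (carrier G)) (\<lambda>n. bfun G \<rho> (inv (u n))) h' sequentially"
  shows "h' (inv a) < 0"
proof -
  have "{x \<in> carrier G. h (inv x) < 0} = {x \<in> carrier G. h' x < 0}"
    using symmetric assms unfolding symmetric_horoballs_space_def by blast
  moreover have "inv a \<in> {x \<in> carrier G. h (inv x) < 0}" using assms by simp
  ultimately show ?thesis by blast
qed

text \<open>The element \<open>inv u \<otimes> a\<close> and its inverse
  \<open>inv a \<otimes> u\<close> have equal norms. The sign of the left-hand side therefore
  decides the last inequality in \<open>spreading\<close> once \<open>f\<close> has been moved to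
  \<open>\<one>\<close>.\<close>

lemma bfun_inv_inv:
  assumes "u \<in> carrier G" "a \<in> carrier G"
  shows "bfun G \<rho> (inv u) (inv a) = \<rho> (inv a \<otimes> u) \<one> - \<rho> u \<one>"
proof -
  have "\<rho> (inv u) (inv a) = \<rho> (inv (inv a \<otimes> u)) \<one>"
    using rho_quotient[of "inv u" "inv a"] assms by (simp add: inv_mult_group)
  then show ?thesis using assms by (simp add: bfun_def rho_inv del: inv_mult_group)
qed

lemma border_nonneg:
  assumes a: "a \<in> carrier G"
  shows "\<exists>h\<in>border G \<rho>. 0 \<le> h a"
proof (rule ccontr)
  assume "\<not> ?thesis"
  then have neg: "\<And>h. h \<in> border G \<rho> \<Longrightarrow> h a < 0" by force
  \<comment> \<open>The surplus \<open>\<rho> a \<one>\<close> keeps the norm of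
    \<open>inv (u n) \<otimes> a\<close> at least \<open>n\<close>.\<close>
  have "\<forall>n. \<exists>u\<in>carrier G. real n + \<rho> a \<one> \<le> \<rho> u \<one>" using unbounded by blast
  then obtain u where u: "\<And>n. u n \<in> carrier G" "\<And>n. real n + \<rho> a \<one> \<le> \<rho> (u n) \<one>" by metis
  have u': "real n \<le> \<rho> (u n) \<one>" for n using u(2)[of n] rho.nonneg[of a \<one>] by linarith
  obtain r h where r: "strict_mono (r::nat\<Rightarrow>nat)"
    and h: "limitin (powertop_real (carrier G)) (\<lambda>n. bfun G \<rho> (u (r n))) h sequentially"
    by (rule bfun_convergent_subsequence[of u, OF u(1)])
  obtain s h' where s: "strict_mono (s::nat\<Rightarrow>nat)"
    and h': "limitin (powertop_real (carrier G)) (\<lambda>n. bfun G \<rho> (inv (u (r (s n))))) h' sequentially"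
    by (rule bfun_convergent_subsequence[of "\<lambda>n. inv (u (r n))"]) (use u(1) in auto)
  obtain t h'' where t: "strict_mono (t::nat\<Rightarrow>nat)"
    and h'': "limitin (powertop_real (carrier G))
      (\<lambda>n. bfun G \<rho> (inv (u (r (s (t n)))) \<otimes> a)) h'' sequentially"
    by (rule bfun_convergent_subsequence[of "\<lambda>n. inv (u (r (s n))) \<otimes> a"]) (use u(1) a in auto)
  define v where "v n = u (r (s (t n)))" for n
  have v: "v n \<in> carrier G" for n using u by (simp add: v_def)
  have mono: "strict_mono (\<lambda>n. r (s (t n)))"
    using r s t by (simp add: strict_mono_def)
  have inf: "goes_to_infinity G v"
    unfolding v_def by (rule goes_to_infinity_subseq(1)[OF u(1) u' mono])
  have hv: "limitin (powertop_real (carrier G)) (\<lambda>n. bfun G \<rho> (v n)) h sequentially"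
    using limitin_subsequence[OF strict_mono_o[OF s t] h] by (simp add: o_def v_def)
  have hv': "limitin (powertop_real (carrier G)) (\<lambda>n. bfun G \<rho> (inv (v n))) h' sequentially"
    using limitin_subsequence[OF t h'] by (simp add: o_def v_def)
  have "h \<in> border G \<rho>" using inf hv by (auto simp: border_def)
  from horoball_inv[OF inf a neg[OF this] hv hv'] have neg': "h' (inv a) < 0" .
  have norm: "\<rho> (inv (v n) \<otimes> a) \<one> = \<rho> (inv a \<otimes> v n) \<one>" for n
    using rho_inv[of "inv a \<otimes> v n"] v a by (simp add: inv_mult_group)
  have "goes_to_infinity G (\<lambda>n. inv (v n) \<otimes> a)"
  proof (rule goes_to_infinityI)
    fix n
    have "\<rho> (inv (v n)) \<one> \<le> \<rho> (inv (v n)) (inv a) + \<rho> (inv a) \<one>"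
      using v a by (intro rho.triangle) auto
    moreover have "\<rho> (inv (v n)) (inv a) = \<rho> (inv (v n) \<otimes> a) \<one>"
      using rho_quotient[of "inv (v n)" "inv a"] v a by simp
    moreover have "n \<le> r (s (t n))" using mono by (rule seq_suble)
    then have "real n + \<rho> a \<one> \<le> \<rho> (v n) \<one>" using u(2)[of "r (s (t n))"] by (simp add: v_def)
    ultimately show "real n \<le> \<rho> (inv (v n) \<otimes> a) \<one>"
      using v a by (simp add: rho_inv)
  qed (use v a in simp)
  moreover have "limitin (powertop_real (carrier G)) (\<lambda>n. bfun G \<rho> (inv (v n) \<otimes> a)) h'' sequentially"
    using h'' by (simp add: v_def)
  ultimately have "h'' \<in> border G \<rho>" and lim'': "(\<lambda>n. bfun G \<rho> (inv (v n) \<otimes> a) a) \<longlonglongrightarrow> h'' a"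
    using a by (auto simp: border_def limitin_powertop_real_iff)
  \<comment> \<open>Both sides equal the norm of \<open>v n\<close> minus the norm of
    \<open>inv a \<otimes> v n\<close>. In the limit, a negative value of \<open>h'\<close> at
    \<open>inv a\<close> becomes a positive value of \<open>h''\<close> at \<open>a\<close>.\<close>
  have "bfun G \<rho> (inv (v n) \<otimes> a) a = - bfun G \<rho> (inv (v n)) (inv a)" for n
  proof -
    have "\<rho> (inv (v n) \<otimes> a) a = \<rho> (v n) \<one>"
      using rho_mult[of "inv (v n)" \<one> a] v a by (simp add: rho_inv del: rho_mult)
    then show ?thesis
      using bfun_inv_inv[OF v a, of n] norm[of n] a by (simp add: bfun_def)
  qed
  moreover have "(\<lambda>n. bfun G \<rho> (inv (v n)) (inv a)) \<longlonglongrightarrow> h' (inv a)"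
    using hv' a by (simp add: limitin_powertop_real_iff)
  ultimately have "(\<lambda>n. bfun G \<rho> (inv (v n) \<otimes> a) a) \<longlonglongrightarrow> - h' (inv a)"
    by (simp add: tendsto_minus)
  with lim'' have "h'' a = - h' (inv a)" by (rule LIMSEQ_unique)
  with neg[OF \<open>h'' \<in> border G \<rho>\<close>] neg' show False by simp
qed

text \<open>If no radius works, the failures for R = 0, 1, 2, ... have a limit: a pair
  \<open>p\<close>, \<open>q\<close> in one fibre and a horofunction \<open>h\<close> on whose
  horoball the pair is close. Then \<open>h\<close> belongs to \<open>ND_eps\<close>, and
  \<open>h a < 0\<close> contradicts, by symmetry, the inequality in
  \<open>spreading\<close>.\<close>

lemma spreading_close_set:
  assumes a: "a \<in> carrier G" and neg: "\<And>h. h \<in> ND_eps G \<rho> X d T \<pi> \<epsilon> \<Longrightarrow> h a < 0"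
    and \<epsilon>: "0 < \<epsilon>"
  shows "\<exists>R. \<forall>x\<in>X. \<forall>y\<in>X. \<pi> x = \<pi> y \<longrightarrow> spreading a R (close_set \<epsilon> x y)"
proof (rule ccontr)
  assume contra: "\<not> ?thesis"
  have "\<exists>u x y. u \<in> carrier G \<and> x \<in> X \<and> y \<in> X \<and> \<pi> x = \<pi> y \<and> real n \<le> \<rho> u \<one> \<and>
      (\<forall>k\<in>carrier G. \<rho> u k < \<rho> u \<one> \<longrightarrow> d (T k x) (T k y) \<le> \<epsilon>) \<and>
      \<rho> u \<one> \<le> \<rho> (inv a \<otimes> u) \<one> \<and> \<epsilon> < d x y" for n
  proof -
    obtain x y where xy: "x \<in> X" "y \<in> X" "\<pi> x = \<pi> y"
      and "\<not> spreading a (real n) (close_set \<epsilon> x y)"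
      using contra by blast
    then obtain g f where gf: "g \<in> carrier G" "f \<in> carrier G" "real n \<le> \<rho> g f"
      "rho.mball g (\<rho> g f) \<subseteq> close_set \<epsilon> x y" "\<rho> g f \<le> \<rho> (inv a \<otimes> g) f" "f \<notin> close_set \<epsilon> x y"
      unfolding spreading_def by blast
    \<comment> \<open>Translating by \<open>f\<close> moves the failing point \<open>f\<close> to \<open>\<one>\<close>.\<close>
    let ?u = "g \<otimes> inv f"
    have norm: "\<rho> ?u \<one> = \<rho> g f" using gf by (simp add: rho_quotient)
    have "inv a \<otimes> ?u = (inv a \<otimes> g) \<otimes> inv f" using gf a by (simp add: m_assoc)
    then have norm': "\<rho> (inv a \<otimes> ?u) \<one> = \<rho> (inv a \<otimes> g) f"
      using gf a by (simp add: rho_quotient)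
    have "d (T k (T f x)) (T k (T f y)) \<le> \<epsilon>" if k: "k \<in> carrier G" "\<rho> ?u k < \<rho> ?u \<one>" for k
    proof -
      have "\<rho> g (k \<otimes> f) < \<rho> g f" using k gf norm by (simp add: rho_shift)
      then have "k \<otimes> f \<in> close_set \<epsilon> x y" using gf k by force
      then show ?thesis using k gf xy by (simp add: close_set_def T_mult)
    qed
    moreover have "\<epsilon> < d (T f x) (T f y)" using gf by (simp add: close_set_def)
    ultimately show ?thesis
      using gf xy norm norm'
      by (intro exI[of _ ?u] exI[of _ "T f x"] exI[of _ "T f y"])
        (simp add: T_closed factor_equivariant)
  qed
  then obtain u x y where u: "\<And>n. u n \<in> carrier G" and xy: "\<And>n. x n \<in> X" "\<And>n. y n \<in> X" "\<And>n. \<pi> (x n) = \<pi> (y n)"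
    and un: "\<And>n. real n \<le> \<rho> (u n) \<one>"
    and close: "\<And>n k. \<lbrakk>k \<in> carrier G; \<rho> (u n) k < \<rho> (u n) \<one>\<rbrakk> \<Longrightarrow> d (T k (x n)) (T k (y n)) \<le> \<epsilon>"
    and far: "\<And>n. \<rho> (u n) \<one> \<le> \<rho> (inv a \<otimes> u n) \<one>" and apart: "\<And>n. \<epsilon> < d (x n) (y n)"
    by metis
  obtain r p q where r: "strict_mono (r::nat\<Rightarrow>nat)" and pq: "p \<in> X" "q \<in> X" "\<pi> p = \<pi> q"
    "limitin mX.mtopology (x \<circ> r) p sequentially" "limitin mX.mtopology (y \<circ> r) q sequentially"
    by (rule fibre_pairs_compact[of x y, OF xy])
  obtain s h where s: "strict_mono (s::nat\<Rightarrow>nat)"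
    and h: "limitin (powertop_real (carrier G)) (\<lambda>n. bfun G \<rho> (u (r (s n)))) h sequentially"
    by (rule bfun_convergent_subsequence[of "\<lambda>n. u (r n)", OF u])
  obtain t h' where t: "strict_mono (t::nat\<Rightarrow>nat)"
    and h': "limitin (powertop_real (carrier G)) (\<lambda>n. bfun G \<rho> (inv (u (r (s (t n)))))) h' sequentially"
    by (rule bfun_convergent_subsequence[of "\<lambda>n. inv (u (r (s n)))"]) (use u in auto)
  define m where "m n = r (s (t n))" for n
  have m: "strict_mono m" using r s t by (simp add: strict_mono_def m_def)
  have inf: "goes_to_infinity G (\<lambda>n. u (m n))"
    by (rule goes_to_infinity_subseq(1)[OF u un m])
  have hm: "limitin (powertop_real (carrier G)) (\<lambda>n. bfun G \<rho> (u (m n))) h sequentially"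
    using limitin_subsequence[OF t h] by (simp add: o_def m_def)
  have hm': "limitin (powertop_real (carrier G)) (\<lambda>n. bfun G \<rho> (inv (u (m n)))) h' sequentially"
    using h' by (simp add: m_def)
  have xm: "limitin mX.mtopology (\<lambda>n. x (m n)) p sequentially"
    using limitin_subsequence[OF strict_mono_o[OF s t] pq(4)] by (simp add: o_def m_def)
  have ym: "limitin mX.mtopology (\<lambda>n. y (m n)) q sequentially"
    using limitin_subsequence[OF strict_mono_o[OF s t] pq(5)] by (simp add: o_def m_def)
  \<comment> \<open>The failure at \<open>\<one>\<close> survives in the limit as a weak inequality,
    which still separates \<open>p\<close> from \<open>q\<close>.\<close>
  have "\<epsilon> \<le> d p q"
    using mX.tendsto_dist[OF xm ym] by (rule Lim_bounded2) (use apart less_imp_le in blast)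
  then have "p \<noteq> q" using \<epsilon> pq by auto
  moreover have "d (T k p) (T k q) \<le> \<epsilon>" if k: "k \<in> horoball G h" for k
  proof -
    have kc: "k \<in> carrier G" and "h k < 0" using k by (auto simp: horoball_def)
    have "(\<lambda>n. bfun G \<rho> (u (m n)) k) \<longlonglongrightarrow> h k"
      using hm kc by (simp add: limitin_powertop_real_iff)
    \<comment> \<open>Once \<open>bfun G \<rho> (u (m n)) k\<close> is negative, \<open>k\<close>
      lies in the open ball around \<open>u (m n)\<close> on which the pair is known to be
      close.\<close>
    from order_tendstoD(2)[OF this \<open>h k < 0\<close>]
    have "\<forall>\<^sub>F n in sequentially. d (T k (x (m n))) (T k (y (m n))) \<le> \<epsilon>"
      by eventually_elim (use kc in \<open>simp add: bfun_def close\<close>)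
    moreover have "(\<lambda>n. d (T k (x (m n))) (T k (y (m n)))) \<longlonglongrightarrow> d (T k p) (T k q)"
      using mX.tendsto_dist[OF continuous_map_limit[OF T_continuous[OF kc] xm]
          continuous_map_limit[OF T_continuous[OF kc] ym]] by (simp add: o_def)
    ultimately show ?thesis
      by (intro tendsto_upperbound[of _ _ sequentially]) auto
  qed
  moreover have "h \<in> border G \<rho>" using inf hm by (auto simp: border_def)
  ultimately have "h \<in> ND_eps G \<rho> X d T \<pi> \<epsilon>" using pq by (auto simp: ND_eps_def)
  from horoball_inv[OF inf a neg[OF this] hm hm'] have "h' (inv a) < 0" .
  moreover have "(\<lambda>n. bfun G \<rho> (inv (u (m n))) (inv a)) \<longlonglongrightarrow> h' (inv a)"
    using hm' a by (simp add: limitin_powertop_real_iff)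
  then have "0 \<le> h' (inv a)"
    by (rule Lim_bounded2) (use bfun_inv_inv[OF u a] far in simp)
  ultimately show False by simp
qed

section \<open>Pigeonhole in a large fibre\<close>

text \<open>A finite cover of \<open>X\<close> by sets on which every \<open>T k\<close> with
  \<open>k\<close> in \<open>F\<close> varies by at most \<open>\<epsilon>\<close>; the colour
  \<open>c x\<close> is a chosen member of the cover containing \<open>x\<close>.\<close>

lemma finite_coding:
  assumes F: "finite F" "F \<subseteq> carrier G" and \<epsilon>: "0 < \<epsilon>"
  obtains C :: "'x set set" and c where "finite C" "\<And>x. x \<in> X \<Longrightarrow> c x \<in> C"
    "\<And>x y k. \<lbrakk>x \<in> X; y \<in> X; c x = c y; k \<in> F\<rbrakk> \<Longrightarrow> d (T k x) (T k y) \<le> \<epsilon>"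
proof -
  \<comment> \<open>The final intersection with \<open>X\<close> matters when \<open>F\<close> is
    empty.\<close>
  define U where "U z = (\<Inter>k\<in>F. {y \<in> X. T k y \<in> mX.mball (T k z) (\<epsilon>/2)}) \<inter> X" for z
  have "openin mX.mtopology (U z)" for z
  proof -
    have "openin mX.mtopology {y \<in> X. T k y \<in> mX.mball (T k z) (\<epsilon>/2)}" if "k \<in> F" for k
      using openin_continuous_map_preimage[OF T_continuous[of k] mX.openin_mball[of "T k z" "\<epsilon>/2"]]
        that F by (auto simp del: mX.in_mball)
    then show ?thesis
      using openin_INT[OF F(1), of mX.mtopology] unfolding U_def by simp
  qed
  moreover have "z \<in> U z" if "z \<in> X" for z
    using that F \<epsilon> T_closed by (auto simp: U_def)
  then have "X \<subseteq> \<Union>(U ` X)" by blast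
  ultimately obtain C where C: "finite C" "C \<subseteq> U ` X" "X \<subseteq> \<Union>C"
    using compact_X unfolding compact_space_alt mX.topspace_mtopology
    by (metis (no_types, lifting) imageE)
  then have "\<forall>x\<in>X. \<exists>V\<in>C. x \<in> V" by blast
  then obtain c where c: "\<And>x. x \<in> X \<Longrightarrow> c x \<in> C" "\<And>x. x \<in> X \<Longrightarrow> x \<in> c x" by metis
  have "d (T k x) (T k y) \<le> \<epsilon>" if xy: "x \<in> X" "y \<in> X" "c x = c y" and k: "k \<in> F" for x y k
  proof -
    obtain z where "z \<in> X" "c x = U z" using c(1)[OF xy(1)] C by blast
    then have "x \<in> U z" "y \<in> U z" using c(2) xy by auto
    then have "T k x \<in> mX.mball (T k z) (\<epsilon>/2)" "T k y \<in> mX.mball (T k z) (\<epsilon>/2)"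
      using k by (auto simp: U_def)
    then show ?thesis
      using mX.triangle[of "T k x" "T k z" "T k y"] by (simp add: mX.commute)
  qed
  with that C(1) c(1) show thesis by blast
qed

lemma large_fibre:
  assumes "\<not> bounded_to_one X Y \<pi>"
  obtains P where "finite P" "P \<subseteq> X" "M < card P" "\<And>p q. \<lbrakk>p \<in> P; q \<in> P\<rbrakk> \<Longrightarrow> \<pi> p = \<pi> q"
proof -
  obtain y where y: "\<not> (finite {x \<in> X. \<pi> x = y} \<and> card {x \<in> X. \<pi> x = y} \<le> M)"
    using assms unfolding bounded_to_one_def by blast
  have "\<exists>P \<subseteq> {x \<in> X. \<pi> x = y}. finite P \<and> card P = Suc M"
  proof (cases "finite {x \<in> X. \<pi> x = y}")
    case True
    with y have "Suc M \<le> card {x \<in> X. \<pi> x = y}" by simp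
    then show ?thesis by (meson obtain_subset_with_card_n)
  next
    case False
    then show ?thesis using infinite_arbitrarily_large by blast
  qed
  then obtain P where P: "P \<subseteq> {x \<in> X. \<pi> x = y}" "finite P" "card P = Suc M" by blast
  show thesis by (rule that[of P]) (use P in auto)
qed

lemma ND_eps_nonneg:
  assumes a: "a \<in> carrier G" and unb: "\<not> bounded_to_one X Y \<pi>" and \<epsilon>: "0 < \<epsilon>"
  shows "\<exists>h\<in>ND_eps G \<rho> X d T \<pi> \<epsilon>. 0 \<le> h a"
proof (rule ccontr)
  assume "\<not> ?thesis"
  then have neg: "\<And>h. h \<in> ND_eps G \<rho> X d T \<pi> \<epsilon> \<Longrightarrow> h a < 0" by force
  then obtain R
    where R: "\<And>x y. \<lbrakk>x \<in> X; y \<in> X; \<pi> x = \<pi> y\<rbrakk> \<Longrightarrow> spreading a R (close_set \<epsilon> x y)"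
    using spreading_close_set[of a \<epsilon>] a \<epsilon> by blast
  \<comment> \<open>The least radius for which \<open>spreading_translate\<close> applies.\<close>
  define r where "r = R + \<rho> a \<one>"
  define F where "F = {k \<in> carrier G. \<rho> k \<one> < r}"
  have "finite F" "F \<subseteq> carrier G"
    by (rule finite_subset[OF _ finite_norm_le[of r]]) (auto simp: F_def)
  then obtain C :: "'x set set" and c where C: "finite C" "\<And>x. x \<in> X \<Longrightarrow> c x \<in> C"
    "\<And>x y k. \<lbrakk>x \<in> X; y \<in> X; c x = c y; k \<in> F\<rbrakk> \<Longrightarrow> d (T k x) (T k y) \<le> \<epsilon>"
    using finite_coding[OF _ _ \<epsilon>] by metis
  obtain P where P: "finite P" "P \<subseteq> X" "card C < card P" "\<And>p q. \<lbrakk>p \<in> P; q \<in> P\<rbrakk> \<Longrightarrow> \<pi> p = \<pi> q"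
    using large_fibre[OF unb] by metis
  \<comment> \<open>There are more points in \<open>P\<close> than colours, so two of the translates
    by \<open>a [^] (- int k)\<close> share a colour and are close on the ball \<open>F\<close>
    around \<open>\<one>\<close>. Translating back gives closeness on the ball around
    \<open>a [^] (- int k)\<close>.\<close>
  have "\<exists>z\<in>P \<times> P. fst z \<noteq> snd z \<and> rho.mball (a [^] (- int k)) r \<subseteq> close_set \<epsilon> (fst z) (snd z)"
    for k :: nat
  proof -
    define b where "b = a [^] (- int k)"
    have b: "b \<in> carrier G" using a by (simp add: b_def)
    have "(\<lambda>p. c (T b p)) ` P \<subseteq> C" using P C(2) T_closed[OF b] by auto
    then have "card ((\<lambda>p. c (T b p)) ` P) < card P"
      using card_mono[OF C(1)] P(3) by (meson le_less_trans)
    then have "\<not> inj_on (\<lambda>p. c (T b p)) P" by (rule pigeonhole)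
    then obtain p q where pq: "p \<in> P" "q \<in> P" "p \<noteq> q" "c (T b p) = c (T b q)"
      by (auto simp: inj_on_def)
    have pqX: "p \<in> X" "q \<in> X" using pq P(2) by auto
    have "f \<in> close_set \<epsilon> p q" if f: "f \<in> rho.mball b r" for f
    proof -
      have fc: "f \<in> carrier G" using f by simp
      have "f \<otimes> inv b \<in> F"
        using f b rho_quotient[of f b] rho.commute[of b f] by (simp add: F_def)
      from C(3)[OF T_closed[OF b pqX(1)] T_closed[OF b pqX(2)] pq(4) this]
      have "f \<otimes> inv b \<in> close_set \<epsilon> (T b p) (T b q)"
        using fc b by (simp add: close_set_def)
      then show ?thesis
        using close_set_translate[OF pqX b, of "f \<otimes> inv b" \<epsilon>] fc b by (simp add: m_assoc)
    qed
    then have "rho.mball b r \<subseteq> close_set \<epsilon> p q" by blast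
    with pq show ?thesis unfolding b_def by force
  qed
  then obtain z where z: "\<And>k. z k \<in> P \<times> P" "\<And>k. fst (z k) \<noteq> snd (z k)"
    "\<And>k. rho.mball (a [^] (- int k)) r \<subseteq> close_set \<epsilon> (fst (z k)) (snd (z k))"
    by metis
  have "finite (range z)"
    by (rule finite_subset[of _ "P \<times> P"]) (use z(1) P(1) in blast)+
  \<comment> \<open>Since \<open>P \<times> P\<close> is finite and does not depend on
    \<open>k\<close>, a single pair occurs for infinitely many \<open>k\<close>.\<close>
  then obtain k\<^sub>0 where inf: "infinite {k. z k = z k\<^sub>0}"
    using pigeonhole_infinite[OF infinite_UNIV_nat] by auto
  define p q where "p = fst (z k\<^sub>0)" and "q = snd (z k\<^sub>0)"
  have "p \<in> P" "q \<in> P" using z(1)[of k\<^sub>0] by (auto simp: p_def q_def mem_Times_iff)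
  then have pq: "p \<in> X" "q \<in> X" "\<pi> p = \<pi> q" using P(2) P(4)[of p q] by auto
  note sp = R[OF pq]
  have "rho.mball (a [^] n) r \<subseteq> close_set \<epsilon> p q" for n :: int
  proof -
    \<comment> \<open>The bound makes \<open>n + int k\<close> nonnegative, so the ball at exponent
      \<open>- int k\<close> can be carried forward to exponent \<open>n\<close>.\<close>
    obtain k where k: "z k = z k\<^sub>0" "nat (- n) \<le> k"
      using inf unfolding infinite_nat_iff_unbounded_le by blast
    have "rho.mball (a [^] (- int k)) r \<subseteq> close_set \<epsilon> p q"
      using z(3)[of k] k by (simp add: p_def q_def)
    from spreading_translate_power[OF sp a _ _ this, of "nat (n + int k)"]
    have "rho.mball (a [^] nat (n + int k) \<otimes> a [^] (- int k)) r \<subseteq> close_set \<epsilon> p q"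
      using a by (simp add: r_def)
    moreover have "a [^] nat (n + int k) = a [^] (n + int k)"
      using k(2) int_pow_int[of G a "nat (n + int k)"] by simp
    then have "a [^] nat (n + int k) \<otimes> a [^] (- int k) = a [^] n"
      using int_pow_mult[OF a, of "n + int k" "- int k"] by simp
    ultimately show ?thesis by simp
  qed
  then have all: "carrier G \<subseteq> close_set \<epsilon> p q"
    using spreading_all[OF sp a, of r] rho.nonneg[of a \<one>] by (simp add: r_def)
  have "p \<noteq> q" using z(2)[of k\<^sub>0] by (simp add: p_def q_def)
  \<comment> \<open>A pair close on all of the group is close on every horoball, so it witnesses
    membership in \<open>ND_eps\<close> for every horofunction.\<close>
  have "d (T k p) (T k q) \<le> \<epsilon>" if "k \<in> horoball G h" for k h
    using that all by (auto simp: horoball_def close_set_def)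
  with pq \<open>p \<noteq> q\<close> have "border G \<rho> \<subseteq> ND_eps G \<rho> X d T \<pi> \<epsilon>"
    unfolding ND_eps_def by blast
  with border_nonneg[OF a] neg show False by force
qed

section \<open>Letting \<epsilon> tend to 0\<close>

text \<open>Witnesses at the scales 1/(n+1) have a subsequence converging in the border. As
  \<open>ND_eps\<close> shrinks with \<epsilon>, the tail of that subsequence lies in each
  \<open>ND_eps\<close>, and closedness puts the limit there too; nonnegativity at \<open>a\<close>
  passes to the limit.\<close>

lemma ND_nonneg:
  assumes a: "a \<in> carrier G" and unb: "\<not> bounded_to_one X Y \<pi>"
    and closed: "\<And>\<epsilon>. \<epsilon> > 0 \<Longrightarrow> closedin (border_topology G \<rho>) (ND_eps G \<rho> X d T \<pi> \<epsilon>)"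
  shows "\<exists>h\<in>ND G \<rho> X d T \<pi>. 0 \<le> h a"
proof -
  have "\<exists>h\<in>ND_eps G \<rho> X d T \<pi> (inverse (real (Suc n))). 0 \<le> h a" for n
    by (rule ND_eps_nonneg[OF a unb]) simp
  then obtain h where h: "\<And>n. h n \<in> ND_eps G \<rho> X d T \<pi> (inverse (real (Suc n)))"
    and nonneg: "\<And>n. 0 \<le> h n a"
    by metis
  have hb: "h n \<in> border G \<rho>" for n using h[of n] by (simp add: ND_eps_def)
  obtain r l where r: "strict_mono (r::nat\<Rightarrow>nat)" and l: "l \<in> border G \<rho>"
    and lim: "limitin (powertop_real (carrier G)) (h \<circ> r) l sequentially"
    by (rule border_compact[of h, OF hb])
  have lim': "limitin (border_topology G \<rho>) (h \<circ> r) l sequentially"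
    using lim l hb by (simp add: border_topology_def limitin_subtopology)
  have "l \<in> ND_eps G \<rho> X d T \<pi> \<epsilon>" if \<epsilon>: "\<epsilon> > 0" for \<epsilon>
  proof (rule limitin_closedin[OF lim' closed[OF \<epsilon>]])
    obtain N where N: "inverse (real (Suc N)) < \<epsilon>" using reals_Archimedean[OF \<epsilon>] by blast
    have "(h \<circ> r) n \<in> ND_eps G \<rho> X d T \<pi> \<epsilon>" if "N \<le> n" for n
    proof -
      have "N \<le> r n" using seq_suble[OF r, of n] that by linarith
      then have "inverse (real (Suc (r n))) \<le> inverse (real (Suc N))"
        by (intro le_imp_inverse_le) auto
      with N have "inverse (real (Suc (r n))) \<le> \<epsilon>" by linarith
      from ND_eps_mono[OF this] show ?thesis using h[of "r n"] by auto
    qed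
    then show "\<forall>\<^sub>F n in sequentially. (h \<circ> r) n \<in> ND_eps G \<rho> X d T \<pi> \<epsilon>"
      by (auto simp: eventually_sequentially)
  qed simp
  then have "l \<in> ND G \<rho> X d T \<pi>" by (simp add: ND_def)
  moreover have "(\<lambda>n. h (r n) a) \<longlonglongrightarrow> l a"
    using lim a by (simp add: limitin_powertop_real_iff)
  then have "0 \<le> l a" by (rule Lim_bounded2) (use nonneg in simp)
  ultimately show ?thesis by blast
qed

end

theorem theorem3p9:
  fixes G :: "('g, 'm) monoid_scheme"
    and \<rho> :: "'g \<Rightarrow> 'g \<Rightarrow> real"
    and X :: "'x set" and d\<^sub>X :: "'x \<Rightarrow> 'x \<Rightarrow> real" and T :: "'g \<Rightarrow> 'x \<Rightarrow> 'x"
    and Y :: "'y set" and d\<^sub>Y :: "'y \<Rightarrow> 'y \<Rightarrow> real" and S :: "'g \<Rightarrow> 'y \<Rightarrow> 'y"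
    and \<pi> :: "'x \<Rightarrow> 'y"
  assumes "group G" and "infinite (carrier G)" and "countable (carrier G)"
    and "right_invariant_metric G \<rho>" and "proper_metric G \<rho>"
    and "symmetric_horoballs_space G \<rho>"
    and "top_dyn_system G X d\<^sub>X T" and "top_dyn_system G Y d\<^sub>Y S"
    and "factor_map G X d\<^sub>X T Y d\<^sub>Y S \<pi>"
    and "\<not> bounded_to_one X Y \<pi>"
    and "\<And>\<epsilon>. \<epsilon> > 0 \<Longrightarrow> closedin (border_topology G \<rho>) (ND_eps G \<rho> X d\<^sub>X T \<pi> \<epsilon>)"
  shows "(\<Inter>h\<in>ND G \<rho> X d\<^sub>X T \<pi>. horoball G h) \<subseteq> Tor G \<and>
         (torsion_free G \<longrightarrow> (\<Inter>h\<in>ND G \<rho> X d\<^sub>X T \<pi>. horoball G h) = {})"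
proof -
  interpret group G by fact
  interpret horoball_factor G \<rho> X d\<^sub>X T Y d\<^sub>Y S \<pi>
    by unfold_locales (use assms in auto)
  note nonneg = ND_nonneg[OF _ assms(10,11)]
  have "a \<notin> (\<Inter>h\<in>ND G \<rho> X d\<^sub>X T \<pi>. horoball G h)" for a
  proof
    assume mem: "a \<in> (\<Inter>h\<in>ND G \<rho> X d\<^sub>X T \<pi>. horoball G h)"
    \<comment> \<open>An intersection over an empty index set would be the whole type, so a member
      of \<open>ND\<close> is needed before \<open>a\<close> is known to lie in
      \<open>carrier G\<close>.\<close>
    obtain h\<^sub>1 where "h\<^sub>1 \<in> ND G \<rho> X d\<^sub>X T \<pi>" using nonneg[OF one_closed] by blast
    with mem have "a \<in> carrier G" by (auto simp: horoball_def)
    from nonneg[OF this] obtain h where "h \<in> ND G \<rho> X d\<^sub>X T \<pi>" "0 \<le> h a" by blast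
    with mem show False by (auto simp: horoball_def)
  qed
  then have "(\<Inter>h\<in>ND G \<rho> X d\<^sub>X T \<pi>. horoball G h) = {}" by blast
  then show ?thesis by blast
qed

end
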